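(* Let $F$ be a distribution on the real line with $F\in\mathcal{OS}$. Then $F\in\mathcal{L}$ if and only if $F^{*2}\in\mathcal{L}$.
   Context: For a distribution $F$ on the real line, $\overline F(x)=1-F(x)$ and $F^{*2}=F*F$ is the convolution of $F$ with itself. All limits are as $x\to\infty$. $F\in\mathcal{L}$ (long-tailed) means $\overline F(x)>0$ for all $x$ and $\lim\overline F(x+1)/\overline F(x)=1$. $F\in\mathcal{OS}$ (generalised subexponential) means $\overline F(x)>0$ for all $x$ and $\limsup\overline{F^{*2}}(x)/\overline F(x)<\infty$. *)

theory Defs
  imports "HOL-Probability.Probability"
begin

text \<open>
  A distribution on the real line is a Borel probability measure, i.e. a measure satisfying
  the library locale \<^locale>\<open>real_distribution\<close>; its distribution function is \<^const>\<open>cdf\<close> and its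
  convolution square is \<open>F \<star> F\<close>. The predicates below are intended for such measures.
\<close>

definition tail :: "real measure \<Rightarrow> real \<Rightarrow> real" where
  "tail F x = 1 - cdf F x"

definition long_tailed :: "real measure \<Rightarrow> bool" where
  "long_tailed F \<longleftrightarrow>
     (\<forall>x. tail F x > 0) \<and> ((\<lambda>x. tail F (x + 1) / tail F x) \<longlongrightarrow> 1) at_top"

text \<open>The limit superior is taken in the extended reals, where it always exists.\<close>

definition generalised_subexponential :: "real measure \<Rightarrow> bool" where
  "generalised_subexponential F \<longleftrightarrow>
     (\<forall>x. tail F x > 0) \<and> Limsup at_top (\<lambda>x. ereal (tail (F \<star> F) x / tail F x)) < \<infinity>"

end

theory Submission
  imports Defs
begin

text \<open>
  Long-tailedness of \<open>F\<close> says that \<open>F (x, x + 1]\<close> is \<open>o(tail F x)\<close>. If \<open>x < X + Y \<le> x + 1\<close> then one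
  of \<open>X\<close>, \<open>Y\<close> is at most \<open>(x + 1) / 2\<close>; conditioning on it, the other one lies in a unit interval
  far to the right, which gives closure of long-tailedness under convolution. Conversely, choose
  \<open>n\<close> with \<open>p = P (n < Y \<le> n + 1) > 0\<close>. Then \<open>p P (z < X \<le> z + 1)\<close> is at most
  \<open>P (z + n < X + Y \<le> z + n + 2)\<close>, which is \<open>o(tail (F \<star> F) z)\<close>, hence \<open>o(tail F z)\<close>
  by generalised subexponentiality.
\<close>

section \<open>Convolution as the law of a sum on the product space\<close>

lemma convolution_emeasure_borel:
  fixes F G :: "real measure"
  assumes "real_distribution F" "real_distribution G" and A [measurable]: "A \<in> sets borel"
  shows "emeasure (F \<star> G) A = emeasure (F \<Otimes>\<^sub>M G) {p. fst p + snd p \<in> A}"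
proof -
  interpret F: real_distribution F by fact
  interpret G: real_distribution G by fact
  show ?thesis
    unfolding convolution_def
    by (subst emeasure_distr) (auto simp: space_pair_measure split_beta' intro!: arg_cong2[where f = emeasure])
qed

text \<open>The product sigma-algebra depends only on those of the factors, so measurability may be
  checked over \<open>borel\<close>.\<close>

lemma Collect_in_sets_pair:
  assumes "real_distribution F" "real_distribution G"
    and "Measurable.pred (borel \<Otimes>\<^sub>M borel) P"
  shows "{p :: real \<times> real. P p} \<in> sets (F \<Otimes>\<^sub>M G)"
proof -
  interpret F: real_distribution F by fact
  interpret G: real_distribution G by fact
  have "sets (F \<Otimes>\<^sub>M G) = sets (borel \<Otimes>\<^sub>M borel)"
    by (intro sets_pair_measure_cong) simp_all
  then show ?thesis
    using predE[OF assms(3)] by (simp add: space_pair_measure)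
qed

lemma real_distribution_convolution:
  fixes F G :: "real measure"
  assumes "real_distribution F" "real_distribution G"
  shows "real_distribution (F \<star> G)"
proof -
  interpret F: real_distribution F by fact
  interpret G: real_distribution G by fact
  interpret P: pair_prob_space F G ..
  have "prob_space (F \<star> G)"
    unfolding convolution_def by (rule P.prob_space_distr) simp
  then show ?thesis
    by (simp add: real_distribution_def real_distribution_axioms_def)
qed

section \<open>Tails and masses of unit intervals\<close>

lemma tail_eq_measure:
  assumes "real_distribution F"
  shows "tail F x = measure F {x<..}"
proof -
  interpret real_distribution F by fact
  have "prob {x<..} = 1 - prob {..x}"
    by (subst prob_compl[symmetric]) (auto intro!: arg_cong[where f = prob])
  then show ?thesis by (simp add: tail_def cdf_def)
qed

lemma tail_antimono:
  assumes "real_distribution F" "x \<le> y"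
  shows "tail F y \<le> tail F x"
proof -
  interpret real_distribution F by fact
  show ?thesis using cdf_nondecreasing[OF assms(2)] by (simp add: tail_def)
qed

lemma tail_diff:
  assumes "real_distribution F" "x \<le> y"
  shows "tail F x - tail F y = measure F {x<..y}"
proof -
  interpret real_distribution F by fact
  show ?thesis
    using cdf_diff_eq[of x y] assms(2) by (cases "x = y") (auto simp: tail_def)
qed

text \<open>For positive tails, the distance of \<open>tail F (x + 1) / tail F x\<close> from 1 is
  the mass of \<open>{x<..x + 1}\<close> divided by \<open>tail F x\<close>. The division-free
  inequality is the form that can be integrated over the other summand.\<close>

lemma long_tailed_iff:
  assumes "real_distribution F"
  shows "long_tailed F \<longleftrightarrow> (\<forall>x. tail F x > 0) \<and>
    (\<forall>e>0. \<forall>\<^sub>F x in at_top. measure F {x<..x + 1} \<le> e * tail F x)"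
proof (cases "\<forall>x. tail F x > 0")
  case True
  have *: "dist (tail F (x + 1) / tail F x) 1 = measure F {x<..x + 1} / tail F x" for x
  proof -
    have "tail F (x + 1) / tail F x - 1 = - measure F {x<..x + 1} / tail F x"
      using tail_diff[OF assms, of x "x + 1"] True[rule_format, of x] by (simp add: field_simps)
    then show ?thesis
      using True[rule_format, of x] by (simp add: dist_real_def)
  qed
  have "((\<lambda>x. tail F (x + 1) / tail F x) \<longlongrightarrow> 1) at_top \<longleftrightarrow>
      (\<forall>e>0. \<forall>\<^sub>F x in at_top. measure F {x<..x + 1} \<le> e * tail F x)" (is "_ \<longleftrightarrow> ?R")
  proof
    assume L: "((\<lambda>x. tail F (x + 1) / tail F x) \<longlongrightarrow> 1) at_top"
    show ?R
    proof (intro allI impI)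
      fix e :: real assume "e > 0"
      show "\<forall>\<^sub>F x in at_top. measure F {x<..x + 1} \<le> e * tail F x"
        using tendstoD[OF L \<open>e > 0\<close>] unfolding *
      proof eventually_elim
        case (elim x)
        then show ?case using True[rule_format, of x] by (simp add: field_simps)
      qed
    qed
  next
    assume R: ?R
    show "((\<lambda>x. tail F (x + 1) / tail F x) \<longlongrightarrow> 1) at_top"
    proof (rule tendstoI, unfold *)
      fix e :: real assume "e > 0"
      \<comment> \<open>Halving \<open>e\<close> turns the weak inequality of \<open>?R\<close> into
        the strict one demanded by \<open>tendstoI\<close>.\<close>
      then have "\<forall>\<^sub>F x in at_top. measure F {x<..x + 1} \<le> e / 2 * tail F x"
        using R half_gt_zero by blast
      then show "\<forall>\<^sub>F x in at_top. measure F {x<..x + 1} / tail F x < e"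
      proof eventually_elim
        case (elim x)
        then have "measure F {x<..x + 1} / tail F x \<le> e / 2"
          using True[rule_format, of x] by (simp add: field_simps)
        with \<open>e > 0\<close> show ?case by linarith
      qed
    qed
  qed
  with True show ?thesis by (simp add: long_tailed_def)
qed (auto simp: long_tailed_def)

section \<open>Lower and upper estimates for the law of a sum\<close>

text \<open>By independence the left side is the mass of the rectangle \<open>A \<times> B\<close>,
  on which the sum falls into \<open>C\<close>.\<close>

lemma measure_product_le_convolution:
  fixes F G :: "real measure"
  assumes F: "real_distribution F" and G: "real_distribution G"
    and [measurable]: "A \<in> sets borel" "B \<in> sets borel" "C \<in> sets borel"
    and sub: "\<And>x y. x \<in> A \<Longrightarrow> y \<in> B \<Longrightarrow> x + y \<in> C"
  shows "measure F A * measure G B \<le> measure (F \<star> G) C"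
proof -
  interpret F: real_distribution F by fact
  interpret G: real_distribution G by fact
  interpret P: pair_prob_space F G ..
  interpret C: real_distribution "F \<star> G"
    using F G by (rule real_distribution_convolution)
  have "emeasure F A * emeasure G B = emeasure (F \<Otimes>\<^sub>M G) (A \<times> B)"
    by (rule G.emeasure_pair_measure_Times[symmetric]) auto
  also have "\<dots> \<le> emeasure (F \<Otimes>\<^sub>M G) {p. fst p + snd p \<in> C}"
    using sub by (intro emeasure_mono Collect_in_sets_pair F G) (auto, measurable)
  also have "\<dots> = emeasure (F \<star> G) C"
    by (simp add: convolution_emeasure_borel F G)
  finally show ?thesis
    by (simp add: F.emeasure_eq_measure G.emeasure_eq_measure C.emeasure_eq_measure
        ennreal_mult[symmetric])
qed

text \<open>Fubini: fix the second coordinate \<open>y\<close>, bound each section by the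
  hypothesis, and integrate. On the right the constraint \<open>snd p \<le> c\<close> is dropped, so
  the integral becomes the full tail of the convolution.\<close>

lemma emeasure_pair_sum_le:
  fixes F G :: "real measure"
  assumes F: "real_distribution F" and G: "real_distribution G"
    and le: "\<And>y. y \<le> c \<Longrightarrow> measure F {x - y<..x + 1 - y} \<le> e * tail F (x - y)"
    and "e \<ge> 0"
  shows "emeasure (F \<Otimes>\<^sub>M G) {p. fst p + snd p \<in> {x<..x + 1} \<and> snd p \<le> c}
    \<le> ennreal e * emeasure (F \<star> G) {x<..}"
proof -
  interpret F: real_distribution F by fact
  interpret G: real_distribution G by fact
  interpret P: pair_prob_space F G ..
  let ?S = "{p. fst p + snd p \<in> {x<..x + 1} \<and> snd p \<le> c} :: (real \<times> real) set"
  let ?T = "{p. fst p + snd p \<in> {x<..}} :: (real \<times> real) set"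
  have S [measurable]: "?S \<in> sets (F \<Otimes>\<^sub>M G)"
    by (rule Collect_in_sets_pair[OF F G]) measurable
  have T [measurable]: "?T \<in> sets (F \<Otimes>\<^sub>M G)"
    by (rule Collect_in_sets_pair[OF F G]) measurable
  have "emeasure (F \<Otimes>\<^sub>M G) ?S = (\<integral>\<^sup>+y. emeasure F ((\<lambda>x. (x, y)) -` ?S) \<partial>G)"
    using S by (rule P.emeasure_pair_measure_alt2)
  also have "\<dots> \<le> (\<integral>\<^sup>+y. ennreal e * emeasure F ((\<lambda>x. (x, y)) -` ?T) \<partial>G)"
  proof (rule nn_integral_mono)
    fix y
    have T': "(\<lambda>x. (x, y)) -` ?T = {x - y<..}" by auto
    show "emeasure F ((\<lambda>x. (x, y)) -` ?S) \<le> ennreal e * emeasure F ((\<lambda>x. (x, y)) -` ?T)"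
    \<comment> \<open>For \<open>y > c\<close> the section of \<open>?S\<close> is empty.\<close>
    proof (cases "y \<le> c")
      case True
      then have S': "(\<lambda>x. (x, y)) -` ?S = {x - y<..x + 1 - y}" by auto
      show ?thesis
        unfolding S' T' using le[OF True] \<open>e \<ge> 0\<close>
        by (simp add: F.emeasure_eq_measure tail_eq_measure[OF F] ennreal_mult[symmetric] ennreal_leI)
    qed simp
  qed
  also have "\<dots> = ennreal e * (\<integral>\<^sup>+y. emeasure F ((\<lambda>x. (x, y)) -` ?T) \<partial>G)"
    by (rule nn_integral_cmult) measurable
  also have "(\<integral>\<^sup>+y. emeasure F ((\<lambda>x. (x, y)) -` ?T) \<partial>G) = emeasure (F \<Otimes>\<^sub>M G) ?T"
    using T by (rule P.emeasure_pair_measure_alt2[symmetric])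
  also have "\<dots> = emeasure (F \<star> G) {x<..}"
    by (simp add: convolution_emeasure_borel F G)
  finally show ?thesis .
qed

text \<open>Brings the case of a small first coordinate into the form of
  \<open>emeasure_pair_sum_le\<close>, with the two factors exchanged.\<close>

lemma emeasure_pair_sum_swap:
  fixes F G :: "real measure"
  assumes F: "real_distribution F" and G: "real_distribution G"
    and [measurable]: "A \<in> sets borel" "B \<in> sets borel"
  shows "emeasure (F \<Otimes>\<^sub>M G) {p. fst p + snd p \<in> A \<and> fst p \<in> B} =
    emeasure (G \<Otimes>\<^sub>M F) {p. fst p + snd p \<in> A \<and> snd p \<in> B}"
proof -
  interpret F: real_distribution F by fact
  interpret G: real_distribution G by fact
  interpret P: pair_sigma_finite F G ..
  have S: "{p. fst p + snd p \<in> A \<and> fst p \<in> B} \<in> sets (F \<Otimes>\<^sub>M G)"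
    by (rule Collect_in_sets_pair[OF F G]) measurable
  show ?thesis
    by (subst P.distr_pair_swap, subst emeasure_distr[OF measurable_pair_swap' S])
      (auto simp: space_pair_measure add.commute split_beta' intro!: arg_cong2[where f = emeasure])
qed

section \<open>Closure of long-tailedness under convolution\<close>

text \<open>The sum exceeds \<open>x\<close> as soon as both summands exceed
  \<open>x / 2\<close>.\<close>

lemma convolution_tail_pos:
  assumes F: "real_distribution F" and G: "real_distribution G"
    and "\<And>x. tail F x > 0" "\<And>x. tail G x > 0"
  shows "tail (F \<star> G) x > 0"
proof -
  have "0 < measure F {x / 2<..} * measure G {x / 2<..}"
    using assms by (simp add: tail_eq_measure)
  also have "\<dots> \<le> measure (F \<star> G) {x<..}"
    by (rule measure_product_le_convolution[OF F G]) auto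
  finally show ?thesis
    by (simp add: tail_eq_measure real_distribution_convolution F G)
qed

lemma long_tailed_convolution:
  assumes F: "real_distribution F" and G: "real_distribution G"
    and LF: "long_tailed F" and LG: "long_tailed G"
  shows "long_tailed (F \<star> G)"
proof -
  interpret F: real_distribution F by fact
  interpret G: real_distribution G by fact
  note C = real_distribution_convolution[OF F G]
  interpret C: real_distribution "F \<star> G" by (rule C)
  show ?thesis
    unfolding long_tailed_iff[OF C]
  proof (intro conjI allI impI)
    show "tail (F \<star> G) x > 0" for x
      using LF LG by (intro convolution_tail_pos F G) (auto simp: long_tailed_def)
    fix e :: real assume "e > 0"
    \<comment> \<open>Each of the two events, small second and small first summand, gets half of
      \<open>e\<close>.\<close>
    define d where "d = e / 2"
    have d: "d > 0" using \<open>e > 0\<close> by (simp add: d_def)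
    have "\<forall>\<^sub>F z in at_top. measure F {z<..z + 1} \<le> d * tail F z \<and> measure G {z<..z + 1} \<le> d * tail G z"
      using LF LG d unfolding long_tailed_iff[OF F] long_tailed_iff[OF G]
      by (intro eventually_conj) auto
    then obtain z0 where z0: "\<And>z. z \<ge> z0 \<Longrightarrow> measure F {z<..z + 1} \<le> d * tail F z"
      "\<And>z. z \<ge> z0 \<Longrightarrow> measure G {z<..z + 1} \<le> d * tail G z"
      unfolding eventually_at_top_linorder by blast
    show "\<forall>\<^sub>F x in at_top. measure (F \<star> G) {x<..x + 1} \<le> e * tail (F \<star> G) x"
      \<comment> \<open>With the cut at \<open>(x + 1) / 2\<close>, the remaining summand lies
        beyond \<open>x - c = (x - 1) / 2\<close>, which is at least \<open>z0\<close> exactly for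
        these \<open>x\<close>.\<close>
      using eventually_ge_at_top[of "2 * z0 + 1"]
    proof eventually_elim
      case (elim x)
      define c where "c = (x + 1) / 2"
      have far: "x - y \<ge> z0" if "y \<le> c" for y
        using that elim by (simp add: c_def field_simps)
      let ?S = "{p. fst p + snd p \<in> {x<..x + 1}} :: (real \<times> real) set"
      let ?A = "{p. fst p + snd p \<in> {x<..x + 1} \<and> snd p \<le> c} :: (real \<times> real) set"
      let ?B = "{p. fst p + snd p \<in> {x<..x + 1} \<and> fst p \<in> {..c}} :: (real \<times> real) set"
      have A: "?A \<in> sets (F \<Otimes>\<^sub>M G)"
        by (rule Collect_in_sets_pair[OF F G]) measurable
      have B: "?B \<in> sets (F \<Otimes>\<^sub>M G)"
        by (rule Collect_in_sets_pair[OF F G]) measurable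
      have "emeasure (F \<star> G) {x<..x + 1} = emeasure (F \<Otimes>\<^sub>M G) ?S"
        by (simp add: convolution_emeasure_borel F G)
      \<comment> \<open>If both coordinates exceeded \<open>c\<close>, their sum would exceed
        \<open>2 * c = x + 1\<close>.\<close>
      also have "\<dots> \<le> emeasure (F \<Otimes>\<^sub>M G) (?A \<union> ?B)"
        using sets.Un[OF A B] by (rule emeasure_mono[rotated]) (auto simp: c_def)
      also have "\<dots> \<le> emeasure (F \<Otimes>\<^sub>M G) ?A + emeasure (F \<Otimes>\<^sub>M G) ?B"
        using A B by (rule emeasure_subadditive)
      also have "emeasure (F \<Otimes>\<^sub>M G) ?A \<le> ennreal d * emeasure (F \<star> G) {x<..}"
        using z0(1)[OF far] d by (intro emeasure_pair_sum_le F G) (auto simp: algebra_simps)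
      also have "emeasure (F \<Otimes>\<^sub>M G) ?B =
          emeasure (G \<Otimes>\<^sub>M F) {p. fst p + snd p \<in> {x<..x + 1} \<and> snd p \<le> c}"
        by (subst emeasure_pair_sum_swap[OF F G]) auto
      also have "\<dots> \<le> ennreal d * emeasure (G \<star> F) {x<..}"
        using z0(2)[OF far] d by (intro emeasure_pair_sum_le F G) (auto simp: algebra_simps)
      also have "(G \<star> F) = (F \<star> G)"
        by (rule convolution_commutative) (simp_all add: F.finite_measure_axioms G.finite_measure_axioms)
      finally have "emeasure (F \<star> G) {x<..x + 1} \<le>
          ennreal d * emeasure (F \<star> G) {x<..} + ennreal d * emeasure (F \<star> G) {x<..}"
        by (simp add: add_mono)
      then show ?case
        using d unfolding C.emeasure_eq_measure tail_eq_measure[OF C]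
        by (simp add: ennreal_mult[symmetric] ennreal_plus[symmetric] d_def del: ennreal_plus)
    qed
  qed
qed

section \<open>Passing from the convolution back to a factor\<close>

text \<open>Countably many such intervals cover \<open>{0<..}\<close>; were all of them null, so
  would be their union.\<close>

lemma exists_unit_interval_pos:
  assumes G: "real_distribution G" and "tail G 0 > 0"
  obtains n :: nat where "measure G {real n<..real n + 1} > 0"
proof (rule ccontr)
  interpret real_distribution G by fact
  assume "\<not> thesis"
  then have "prob {real n<..real n + 1} = 0" for n
    using that[of n] measure_nonneg[of G "{real n<..real n + 1}"] by linarith
  then have "emeasure G (\<Union>n. {real n<..real n + 1}) = 0"
    by (intro emeasure_UN_eq_0) (auto simp: emeasure_eq_measure)
  moreover have "{0<..} \<subseteq> (\<Union>n. {real n<..real n + 1})"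
  proof
    fix x :: real assume x: "x \<in> {0<..}"
    \<comment> \<open>The intervals are open on the left, so the index is the ceiling minus one; it
      is nonnegative because \<open>x > 0\<close>.\<close>
    then have "real (nat (\<lceil>x\<rceil> - 1)) = of_int \<lceil>x\<rceil> - 1"
      by simp
    then have "x \<in> {real (nat (\<lceil>x\<rceil> - 1))<..real (nat (\<lceil>x\<rceil> - 1)) + 1}"
      by (simp; linarith)
    then show "x \<in> (\<Union>n. {real n<..real n + 1})" by blast
  qed
  ultimately have "emeasure G {0<..} \<le> 0"
    using emeasure_mono[of "{0<..}" "\<Union>n. {real n<..real n + 1}" G] by auto
  then show False
    using assms(2) by (simp add: tail_eq_measure[OF G] measure_def)
qed

lemma long_tailed_of_convolution:
  assumes F: "real_distribution F" and G: "real_distribution G"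
    and pos: "\<And>x. tail F x > 0" "tail G 0 > 0"
    and bound: "\<forall>\<^sub>F x in at_top. tail (F \<star> G) x \<le> K * tail F x"
    and L: "long_tailed (F \<star> G)"
  shows "long_tailed F"
proof -
  note C = real_distribution_convolution[OF F G]
  interpret C: real_distribution "F \<star> G" by (rule C)
  obtain n where n: "measure G {real n<..real n + 1} > 0"
    using exists_unit_interval_pos[OF G pos(2)] .
  define p where "p = measure G {real n<..real n + 1}"
  \<comment> \<open>The sign of \<open>K\<close> is unknown; \<open>M\<close> is a positive bound by
    which one may divide.\<close>
  define M where "M = max K 1"
  have p: "p > 0" and M: "M > 0" "K \<le> M" using n by (auto simp: p_def M_def)
  show ?thesis
    unfolding long_tailed_iff[OF F]
  proof (intro conjI allI impI pos(1))
    fix e :: real assume "e > 0"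
    \<comment> \<open>The 2 pays for two unit intervals, \<open>M\<close> for replacing the tail of
      \<open>F \<star> G\<close> by that of \<open>F\<close>, and \<open>p\<close> is cancelled at
      the end.\<close>
    define d where "d = e * p / (2 * M)"
    have d: "d > 0" using \<open>e > 0\<close> p M by (simp add: d_def)
    have "\<forall>\<^sub>F x in at_top. measure (F \<star> G) {x<..x + 1} \<le> d * tail (F \<star> G) x"
      using L d unfolding long_tailed_iff[OF C] by blast
    then obtain x0 where x0:
      "\<And>x. x \<ge> x0 \<Longrightarrow> measure (F \<star> G) {x<..x + 1} \<le> d * tail (F \<star> G) x"
      unfolding eventually_at_top_linorder by blast
    show "\<forall>\<^sub>F z in at_top. measure F {z<..z + 1} \<le> e * tail F z"
      using bound eventually_ge_at_top[of x0]
    proof eventually_elim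
      case (elim z)
      \<comment> \<open>Unit intervals to the right of \<open>z\<close> are all compared with the
        tail at \<open>z\<close> itself, where \<open>bound\<close> applies, so the shift by
        \<open>n\<close> costs nothing.\<close>
      have step: "measure (F \<star> G) {x<..x + 1} \<le> d * tail (F \<star> G) z" if "x \<ge> z" for x
      proof -
        have "measure (F \<star> G) {x<..x + 1} \<le> d * tail (F \<star> G) x"
          using that elim by (intro x0) simp
        also have "\<dots> \<le> d * tail (F \<star> G) z"
          using that d by (intro mult_left_mono tail_antimono[OF C]) auto
        finally show ?thesis .
      qed
      define x where "x = z + real n"
      \<comment> \<open>Adding two unit intervals gives an interval of length 2, which is then cut
        into two unit intervals.\<close>
      have "measure F {z<..z + 1} * p \<le> measure (F \<star> G) {x<..x + 2}"
        unfolding p_def x_def by (rule measure_product_le_convolution[OF F G]) auto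
      also have "\<dots> = measure (F \<star> G) {x<..x + 1} + measure (F \<star> G) {x + 1<..(x + 1) + 1}"
        by (simp add: tail_diff[OF C, symmetric] add.commute)
      also have "\<dots> \<le> 2 * d * tail (F \<star> G) z"
        using step[of x] step[of "x + 1"] by (simp add: x_def)
      also have "\<dots> \<le> 2 * d * (M * tail F z)"
        using elim(1) M(2) d pos(1)[of z]
        by (intro mult_left_mono order_trans[OF elim(1)] mult_right_mono) auto
      also have "\<dots> = (e * tail F z) * p"
        using M by (simp add: d_def)
      finally show ?case using p by simp
    qed
  qed
qed

section \<open>Generalised subexponentiality and the equivalence\<close>

lemma generalised_subexponential_bound:
  assumes "generalised_subexponential F"
  obtains K where "\<forall>\<^sub>F x in at_top. tail (F \<star> F) x \<le> K * tail F x"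
proof -
  have pos: "tail F x > 0" for x
    using assms by (simp add: generalised_subexponential_def)
  \<comment> \<open>Lying strictly between the limit superior and infinity, \<open>b\<close> is
    neither infinite value and hence a real number.\<close>
  obtain b where b: "Limsup at_top (\<lambda>x. ereal (tail (F \<star> F) x / tail F x)) < b" "b < \<infinity>"
    using assms dense unfolding generalised_subexponential_def by blast
  then obtain K where K: "b = ereal K"
    by (cases b) auto
  have "\<forall>\<^sub>F x in at_top. ereal (tail (F \<star> F) x / tail F x) < b"
    using Limsup_lessD[OF b(1)] .
  then have "\<forall>\<^sub>F x in at_top. tail (F \<star> F) x \<le> K * tail F x"
  proof eventually_elim
    case (elim x)
    then show ?case using pos[of x] by (simp add: K field_simps)
  qed
  then show thesis by (rule that)
qed

theorem proposition2p2:
  fixes F :: "real measure"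
  assumes "real_distribution F"
    and "generalised_subexponential F"
  shows "long_tailed F \<longleftrightarrow> long_tailed (F \<star> F)"
proof
  assume "long_tailed F"
  then show "long_tailed (F \<star> F)"
    using assms(1) by (intro long_tailed_convolution)
next
  assume L: "long_tailed (F \<star> F)"
  have pos: "tail F x > 0" for x
    using assms(2) by (simp add: generalised_subexponential_def)
  obtain K where "\<forall>\<^sub>F x in at_top. tail (F \<star> F) x \<le> K * tail F x"
    using generalised_subexponential_bound[OF assms(2)] .
  then show "long_tailed F"
    using L by (rule long_tailed_of_convolution[OF assms(1) assms(1) pos pos])
qed

end
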